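(* Let $G$ and $H$ be finite, simple, connected graphs and let $U\subseteq V(G)$ with $|U|>1$. Then $$\mathrm{edim}(G(U)\sqcap H)\leq n(H)\,\bigl(\mathrm{edim}^+(G(U))+1\bigr),$$ where $n(H)=|V(H)|$, $G(U)\sqcap H$ is the hierarchical product of $G$ and $H$ with respect to $U$, $\mathrm{edim}$ is the edge metric dimension, and $\mathrm{edim}^+(G(U))$ is the invariant defined in the context.
   Context: All graphs are finite, simple and connected; $d_G(u,v)$ is the shortest-path distance, and $n(H)=|V(H)|$. Distance from a vertex to an edge: for $u\in V(G)$ and $xy\in E(G)$, $d_G(u,xy)=\min\{d_G(u,x),d_G(u,y)\}$. Metric generators: for $X\subseteq V(G)$, a set $S\subseteq V(G)$ is a metric generator for $X$ if for any two distinct $x,x'\in X$ there is $s\in S$ with $d_G(s,x)\ne d_G(s,x')$. For $F\subseteq E(G)$, a set $S\subseteq V(G)$ is an edge metric generator for $F$ if for any two distinct $e,f\in F$ there is $s\in S$ with $d_G(s,e)\neq d_G(s,f)$. The edge metric dimension $\mathrm{edim}(G)$ is the minimum cardinality of an edge metric generator for $E(G)$. Hierarchical product: for graphs $G,H$ and $U\subseteq V(G)$, $G(U)\sqcap H$ has vertex set $V(G)\times V(H)$ and edge set $$\{(g,h)(g',h'): gg'\in E(G),\ h=h'\}\cup\{(g,h)(g',h'): g=g'\in U,\ hh'\in E(H)\}.$$ Equidistant discriminators: for $v\in V(G)$ and an integer $k\ge 0$ let $E_G(v,k)=\{e\in E(G): d_G(v,e)=k\}$. If $F\subseteq E(G)$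 and $|F|\ge 2$, a set $X\subseteq V(G)$ is an equidistant discriminator for $F$ if $X$ is an edge metric generator for $F$; if $|F|\le 1$, the only equidistant discriminator for $F$ is $\emptyset$. Analogously, for $Y\subseteq V(G)$ with $|Y|\ge 2$, a set $X\subseteq V(G)$ is an equidistant discriminator for $Y$ if $X$ is a metric generator for $Y$; if $|Y|\le 1$, the only equidistant discriminator for $Y$ is $\emptyset$. The invariant $\mathrm{edim}^+$: $$\mathrm{edim}^+(G(U))=\min\left|\Bigl(\bigcup_{u\in U,\,k\ge 0}S_G(u,k)\Bigr)\cup S_G(U)\right|,$$ where the minimum is taken over all choices of equidistant discriminators $S_G(u,k)$ for $E_G(u,k)$ ($u\in U$, $k\ge 0$) and all equidistant discriminators $S_G(U)$ for $U$. *)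

theory Defs
  imports Main
begin

datatype 'a graph = Graph (verts: "'a set") (edges: "'a set set")

definition simple_graph :: "'a graph \<Rightarrow> bool" where
  "simple_graph G \<longleftrightarrow>
     finite (verts G) \<and> verts G \<noteq> {} \<and> (\<forall>e\<in>edges G. e \<subseteq> verts G \<and> card e = 2)"

text \<open>A path is given by its nonempty list of vertices; its length is the number of edges,
  i.e. one less than the length of the list.\<close>

definition is_path :: "'a graph \<Rightarrow> 'a \<Rightarrow> 'a list \<Rightarrow> 'a \<Rightarrow> bool" where
  "is_path G u p v \<longleftrightarrow>
     p \<noteq> [] \<and> hd p = u \<and> last p = v \<and> distinct p \<and> set p \<subseteq> verts G \<and>
     (\<forall>i. Suc i < length p \<longrightarrow> {p ! i, p ! Suc i} \<in> edges G)"

definition connected_graph :: "'a graph \<Rightarrow> bool" where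
  "connected_graph G \<longleftrightarrow>
     simple_graph G \<and> (\<forall>u\<in>verts G. \<forall>v\<in>verts G. \<exists>p. is_path G u p v)"

text \<open>Only meaningful for vertices joined by a path.\<close>

definition gdist :: "'a graph \<Rightarrow> 'a \<Rightarrow> 'a \<Rightarrow> nat" where
  "gdist G u v = (LEAST n. \<exists>p. is_path G u p v \<and> length p = Suc n)"

definition edge_dist :: "'a graph \<Rightarrow> 'a \<Rightarrow> 'a set \<Rightarrow> nat" where
  "edge_dist G u e = Min (gdist G u ` e)"

definition metric_generator :: "'a graph \<Rightarrow> 'a set \<Rightarrow> 'a set \<Rightarrow> bool" where
  "metric_generator G X S \<longleftrightarrow>
     S \<subseteq> verts G \<and>
     (\<forall>x\<in>X. \<forall>x'\<in>X. x \<noteq> x' \<longrightarrow> (\<exists>s\<in>S. gdist G s x \<noteq> gdist G s x'))"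

definition edge_metric_generator :: "'a graph \<Rightarrow> 'a set set \<Rightarrow> 'a set \<Rightarrow> bool" where
  "edge_metric_generator G F S \<longleftrightarrow>
     S \<subseteq> verts G \<and>
     (\<forall>e\<in>F. \<forall>f\<in>F. e \<noteq> f \<longrightarrow> (\<exists>s\<in>S. edge_dist G s e \<noteq> edge_dist G s f))"

definition edim :: "'a graph \<Rightarrow> nat" where
  "edim G = (LEAST n. \<exists>S. edge_metric_generator G (edges G) S \<and> card S = n)"

definition hierarchical_product :: "'a graph \<Rightarrow> 'a set \<Rightarrow> 'b graph \<Rightarrow> ('a \<times> 'b) graph" where
  "hierarchical_product G U H = Graph (verts G \<times> verts H)
     ({{(g, h), (g', h)} | g g' h. {g, g'} \<in> edges G \<and> h \<in> verts H} \<union>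
      {{(g, h), (g, h')} | g h h'. g \<in> U \<and> {h, h'} \<in> edges H})"

definition edges_at_dist :: "'a graph \<Rightarrow> 'a \<Rightarrow> nat \<Rightarrow> 'a set set" where
  "edges_at_dist G v k = {e \<in> edges G. edge_dist G v e = k}"

definition edge_discriminator :: "'a graph \<Rightarrow> 'a set set \<Rightarrow> 'a set \<Rightarrow> bool" where
  "edge_discriminator G F X \<longleftrightarrow>
     (if card F \<ge> 2 then edge_metric_generator G F X else X = {})"

definition vertex_discriminator :: "'a graph \<Rightarrow> 'a set \<Rightarrow> 'a set \<Rightarrow> bool" where
  "vertex_discriminator G Y X \<longleftrightarrow>
     (if card Y \<ge> 2 then metric_generator G Y X else X = {})"

definition edim_plus :: "'a graph \<Rightarrow> 'a set \<Rightarrow> nat" where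
  "edim_plus G U = (LEAST n. \<exists>SE SU.
     (\<forall>u\<in>U. \<forall>k. edge_discriminator G (edges_at_dist G u k) (SE u k)) \<and>
     vertex_discriminator G U SU \<and>
     card ((\<Union>u\<in>U. \<Union>k. SE u k) \<union> SU) = n)"

end

theory Submission
  imports Defs
begin

text \<open>
  Write \<open>P\<close> for the hierarchical product.  A path of \<open>P\<close> can change its \<open>H\<close>-coordinate
  only while its \<open>G\<close>-coordinate lies in \<open>U\<close>.  Hence between two vertices that lie in the same copy
  of \<open>G\<close>, or one of which has its \<open>G\<close>-coordinate in \<open>U\<close>, the distance of \<open>P\<close> is simply the sum of
  the distances of the two coordinates (lemma \<open>gdist_product\<close>): moving first in one coordinate and
  then in the other is possible, and nothing shorter is.  An edge of \<open>P\<close> is a copy \<open>e \<times> {h}\<close> of an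
  edge of \<open>G\<close> or a copy \<open>{u} \<times> f\<close> of an edge of \<open>H\<close> with \<open>u \<in> U\<close>, so distances to edges
  split as sums as well.

  Let \<open>D\<close> be a set of vertices attaining \<open>edim_plus G U\<close>, and choose any \<open>w \<in> U\<close>.  The set
  \<open>(D \<union> {w}) \<times> V(H)\<close>, which has at most \<open>n(H) (edim_plus G U + 1)\<close> elements, distinguishes the
  edges of \<open>P\<close>.  The vertices \<open>(w, h)\<close> see the whole product through the sum formula and separate
  all pairs of edges except two kinds: two edges \<open>e \<times> {h}\<close> and \<open>f \<times> {h}\<close> of the same copy of \<open>G\<close>
  with \<open>e\<close> and \<open>f\<close> equally far from \<open>w\<close>, and two edges \<open>{u} \<times> f\<close> and \<open>{u'} \<times> f\<close> over the
  same edge \<open>f\<close> of \<open>H\<close>.  The first kind is separated by the discriminator for the edges of \<open>G\<close> at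
  a given distance from \<open>w\<close>, placed in the copy \<open>h\<close>; the second by the discriminator for \<open>U\<close>, placed
  in a copy that \<open>f\<close> touches.
\<close>

section \<open>Distances and walks\<close>

text \<open>Distances are defined by paths without repeated vertices, which do not compose.  Walks do:
  they are the powers of the adjacency relation, so the distance is better handled as the least
  exponent that relates two vertices.\<close>

definition adj :: "'a graph \<Rightarrow> ('a \<times> 'a) set" where
  "adj G = {(x, y). y \<in> verts G \<and> {x, y} \<in> edges G}"

text \<open>Appending a vertex to a path either gives a path, or the vertex was already visited, and then
  an initial part of the path leads to it.\<close>

lemma path_of_walk:
  assumes "(u, v) \<in> adj G ^^ n" "u \<in> verts G"
  shows "\<exists>p. is_path G u p v \<and> length p \<le> Suc n"
  using assms(1)
proof (induction n arbitrary: v)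
  case 0
  then have "is_path G u [u] v"
    using assms(2) by (auto simp: is_path_def)
  then show ?case by force
next
  case (Suc n)
  then obtain x where x: "(u, x) \<in> adj G ^^ n" "(x, v) \<in> adj G"
    by auto
  then obtain p where p: "is_path G u p x" "length p \<le> Suc n"
    using Suc.IH by blast
  show ?case
  proof (cases "v \<in> set p")
    case True
    then obtain i where i: "i < length p" "p ! i = v"
      by (auto simp: in_set_conv_nth)
    have "last (take (Suc i) p) = v"
      using i by (simp add: take_Suc_conv_app_nth)
    then have "is_path G u (take (Suc i) p) v"
      using p(1) by (auto simp: is_path_def dest: in_set_takeD)
    then show ?thesis
      using p(2) by (intro exI[of _ "take (Suc i) p"]) auto
  next
    case False
    have "{(p @ [v]) ! i, (p @ [v]) ! Suc i} \<in> edges G" if "Suc i < length (p @ [v])" for i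
    proof (cases "Suc i < length p")
      case True
      then show ?thesis using p(1) by (auto simp: is_path_def nth_append)
    next
      case False
      then have "i = length p - 1" "p \<noteq> []"
        using that p(1) by (auto simp: is_path_def)
      then have "(p @ [v]) ! i = x" "(p @ [v]) ! Suc i = v"
        using p(1) by (auto simp: is_path_def nth_append last_conv_nth)
      then show ?thesis using x(2) by (simp add: adj_def)
    qed
    then have "is_path G u (p @ [v]) v"
      using p(1) False x(2) by (auto simp: is_path_def adj_def)
    then show ?thesis
      using p(2) by (intro exI[of _ "p @ [v]"]) auto
  qed
qed

lemma walk_of_path:
  assumes "is_path G u p v" "length p = Suc n"
  shows "(u, v) \<in> adj G ^^ n"
proof -
  have "(u, p ! i) \<in> adj G ^^ i" if "i \<le> n" for i
    using that
  proof (induction i)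
    case 0
    then show ?case using assms(1) by (auto simp: is_path_def hd_conv_nth)
  next
    case (Suc i)
    then have "{p ! i, p ! Suc i} \<in> edges G" "p ! Suc i \<in> verts G"
      using assms by (auto simp: is_path_def)
    then have "(p ! i, p ! Suc i) \<in> adj G" by (simp add: adj_def)
    then show ?case using Suc by auto
  qed
  from this[of n] show ?thesis
    using assms by (auto simp: is_path_def last_conv_nth)
qed

lemma gdist_le_walk:
  assumes "(u, v) \<in> adj G ^^ n" "u \<in> verts G"
  shows "gdist G u v \<le> n"
proof -
  obtain p where p: "is_path G u p v" "length p \<le> Suc n"
    using path_of_walk[OF assms] by blast
  then have "length p = Suc (length p - 1)"
    by (auto simp: is_path_def)
  then have "gdist G u v \<le> length p - 1"
    unfolding gdist_def using p(1) by (intro Least_le) blast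
  then show ?thesis using p(2) by simp
qed

lemma walk_gdist:
  assumes "is_path G u p v"
  shows "(u, v) \<in> adj G ^^ gdist G u v"
proof -
  have "length p = Suc (length p - 1)"
    using assms by (auto simp: is_path_def)
  then have "\<exists>n p. is_path G u p v \<and> length p = Suc n"
    using assms by blast
  then have "\<exists>p. is_path G u p v \<and> length p = Suc (gdist G u v)"
    unfolding gdist_def by (rule LeastI_ex)
  then show ?thesis using walk_of_path by metis
qed

lemma connected_walk_gdist:
  assumes "connected_graph G" "u \<in> verts G" "v \<in> verts G"
  shows "(u, v) \<in> adj G ^^ gdist G u v"
  using assms walk_gdist unfolding connected_graph_def by metis

lemma gdist_self [simp]: "u \<in> verts G \<Longrightarrow> gdist G u u = 0"
  using gdist_le_walk[where n = 0 and u = u and v = u] by simp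

lemma gdist_eq_0:
  assumes "connected_graph G" "u \<in> verts G" "v \<in> verts G"
  shows "gdist G u v = 0 \<longleftrightarrow> u = v"
  using connected_walk_gdist[OF assms] assms(2) by auto

lemma gdist_adj_le:
  assumes "connected_graph G" "u \<in> verts G" "x \<in> verts G" "(x, y) \<in> adj G"
  shows "gdist G u y \<le> Suc (gdist G u x)"
  using connected_walk_gdist[OF assms(1-3)] assms(2,4)
  by (intro gdist_le_walk) auto

text \<open>A function that grows by at most one along every edge bounds the length of a walk from below.\<close>

lemma walk_potential_le:
  fixes \<phi> :: "'a \<Rightarrow> nat"
  assumes "\<And>x y. x \<in> verts G \<Longrightarrow> (x, y) \<in> adj G \<Longrightarrow> \<phi> y \<le> Suc (\<phi> x)"
    and "(u, v) \<in> adj G ^^ n" "u \<in> verts G"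
  shows "\<phi> v \<le> \<phi> u + n \<and> v \<in> verts G"
  using assms(2)
proof (induction n arbitrary: v)
  case 0
  then show ?case using assms(3) by auto
next
  case (Suc n)
  then obtain x where x: "(u, x) \<in> adj G ^^ n" "(x, v) \<in> adj G"
    by auto
  then have "\<phi> x \<le> \<phi> u + n" "x \<in> verts G" "v \<in> verts G"
    using Suc.IH by (auto simp: adj_def)
  then show ?case using assms(1)[OF _ x(2)] by simp
qed

lemma walk_map:
  assumes "\<And>x y. (x, y) \<in> adj G \<Longrightarrow> (\<phi> x, \<phi> y) \<in> adj K" "(u, v) \<in> adj G ^^ n"
  shows "(\<phi> u, \<phi> v) \<in> adj K ^^ n"
  using assms(2) by (induction n arbitrary: v) (auto intro: assms(1))

section \<open>Distances to edges\<close>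

lemma connected_graph_edge:
  assumes "connected_graph G" "e \<in> edges G"
  shows "e \<subseteq> verts G" "finite e" "e \<noteq> {}" "card e = 2"
proof -
  show "e \<subseteq> verts G" "card e = 2"
    using assms by (auto simp: connected_graph_def simple_graph_def)
  then show "finite e" "e \<noteq> {}"
    by (auto intro: card_ge_0_finite)
qed

lemma edge_dist_eq_0:
  assumes "connected_graph G" "e \<in> edges G" "v \<in> verts G"
  shows "edge_dist G v e = 0 \<longleftrightarrow> v \<in> e"
proof -
  note e = connected_graph_edge[OF assms(1,2)]
  have "edge_dist G v e = 0 \<longleftrightarrow> 0 \<in> gdist G v ` e"
    unfolding edge_dist_def using e
    by (metis Min_eqI Min_in finite_imageI image_is_empty zero_le)
  also have "\<dots> \<longleftrightarrow> (\<exists>x\<in>e. gdist G v x = 0)"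
    by force
  also have "\<dots> \<longleftrightarrow> v \<in> e"
    using gdist_eq_0[OF assms(1,3)] e(1) by blast
  finally show ?thesis .
qed

lemma edge_subset_eq:
  assumes "connected_graph G" "e \<in> edges G" "f \<in> edges G" "e \<subseteq> f"
  shows "e = f"
  using connected_graph_edge[OF assms(1,2)] connected_graph_edge[OF assms(1,3)] assms(4)
  by (simp add: card_subset_eq)

lemma finite_edges:
  assumes "connected_graph G"
  shows "finite (edges G)"
proof (rule finite_subset)
  show "edges G \<subseteq> Pow (verts G)"
    using connected_graph_edge(1)[OF assms] by blast
  show "finite (Pow (verts G))"
    using assms by (simp add: connected_graph_def simple_graph_def)
qed

lemma edge_metric_generator_verts:
  assumes "connected_graph G" "F \<subseteq> edges G"
  shows "edge_metric_generator G F (verts G)"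
  unfolding edge_metric_generator_def
proof (intro conjI ballI impI subset_refl)
  fix e f assume ef: "e \<in> F" "f \<in> F" "e \<noteq> f"
  then have "e \<in> edges G" "f \<in> edges G" using assms(2) by auto
  moreover from this obtain v where "v \<in> e" "v \<notin> f"
    using edge_subset_eq[OF assms(1)] ef(3) by blast
  moreover have "v \<in> verts G"
    using calculation connected_graph_edge(1)[OF assms(1)] by blast
  ultimately show "\<exists>s\<in>verts G. edge_dist G s e \<noteq> edge_dist G s f"
    using edge_dist_eq_0[OF assms(1)] by metis
qed

lemma metric_generator_verts:
  assumes "connected_graph G" "U \<subseteq> verts G"
  shows "metric_generator G U (verts G)"
  unfolding metric_generator_def
proof (intro conjI ballI impI subset_refl)
  fix x x' assume x: "x \<in> U" "x' \<in> U" "x \<noteq> x'"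
  then have "x \<in> verts G" "x' \<in> verts G" using assms(2) by auto
  then have "gdist G x x \<noteq> gdist G x x'"
    using gdist_eq_0[OF assms(1), of x x'] x(3) by simp
  then show "\<exists>s\<in>verts G. gdist G s x \<noteq> gdist G s x'"
    using \<open>x \<in> verts G\<close> by blast
qed

text \<open>The whole vertex set serves as a discriminator for every set that needs one, so the minimum
  defining \<open>edim_plus\<close> ranges over a nonempty set and is attained.\<close>

lemma edim_plus_attained:
  assumes "connected_graph G" "U \<subseteq> verts G"
  obtains SE SU where
    "\<And>u k. u \<in> U \<Longrightarrow> edge_discriminator G (edges_at_dist G u k) (SE u k)"
    "vertex_discriminator G U SU"
    "card ((\<Union>u\<in>U. \<Union>k. SE u k) \<union> SU) = edim_plus G U"
proof -
  let ?Q = "\<lambda>n. \<exists>SE SU.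
     (\<forall>u\<in>U. \<forall>k. edge_discriminator G (edges_at_dist G u k) (SE u k)) \<and>
     vertex_discriminator G U SU \<and>
     card ((\<Union>u\<in>U. \<Union>k. SE u k) \<union> SU) = n"
  let ?SE = "\<lambda>u k. if card (edges_at_dist G u k) \<ge> 2 then verts G else {}"
  let ?SU = "if card U \<ge> 2 then verts G else {}"
  have "edge_discriminator G (edges_at_dist G u k) (?SE u k)" for u k
    using edge_metric_generator_verts[OF assms(1), of "edges_at_dist G u k"]
    by (auto simp: edge_discriminator_def edges_at_dist_def)
  moreover have "vertex_discriminator G U ?SU"
    using metric_generator_verts[OF assms] by (simp add: vertex_discriminator_def)
  ultimately have "?Q (card ((\<Union>u\<in>U. \<Union>k. ?SE u k) \<union> ?SU))"
    by (intro exI[of _ ?SE] exI[of _ ?SU] conjI allI ballI refl)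
  then have "\<exists>n. ?Q n" by (rule exI)
  then have "?Q (edim_plus G U)"
    unfolding edim_plus_def by (rule LeastI_ex)
  then show ?thesis using that by blast
qed

section \<open>Distances in the hierarchical product\<close>

locale hierarchical =
  fixes G :: "'a graph" and H :: "'b graph" and U :: "'a set"
  assumes G: "connected_graph G" and H: "connected_graph H" and U: "U \<subseteq> verts G"
begin

abbreviation P :: "('a \<times> 'b) graph" where
  "P \<equiv> hierarchical_product G U H"

lemma verts_product [simp]: "verts P = verts G \<times> verts H"
  by (simp add: hierarchical_product_def)

lemma product_edge_cases:
  assumes "E \<in> edges P"
  obtains (copy_G) e h where "e \<in> edges G" "h \<in> verts H" "E = (\<lambda>x. (x, h)) ` e"
    | (copy_H) u f where "u \<in> U" "f \<in> edges H" "E = Pair u ` f"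
  using assms unfolding hierarchical_product_def
proof (simp, elim disjE exE conjE)
  fix g g' h
  assume "E = {(g, h), (g', h)}" "{g, g'} \<in> edges G" "h \<in> verts H"
  then show thesis by (intro copy_G[of "{g, g'}" h]) auto
next
  fix g h h'
  assume "E = {(g, h), (g, h')}" "g \<in> U" "{h, h'} \<in> edges H"
  then show thesis by (intro copy_H[of g "{h, h'}"]) auto
qed

lemma adj_product:
  "((x, y), (x', y')) \<in> adj P \<longleftrightarrow>
     (x, x') \<in> adj G \<and> y = y' \<and> y \<in> verts H \<or> x = x' \<and> x \<in> U \<and> (y, y') \<in> adj H"
proof -
  have "{(x, y), (x', y')} \<in> edges P \<longleftrightarrow>
     {x, x'} \<in> edges G \<and> y = y' \<and> y \<in> verts H \<or> x = x' \<and> x \<in> U \<and> {y, y'} \<in> edges H"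
    (is "?l \<longleftrightarrow> ?r")
  proof
    assume ?l
    then show ?r
      unfolding hierarchical_product_def
      by (auto simp: doubleton_eq_iff insert_commute)
  next
    assume ?r
    then show ?l
      unfolding hierarchical_product_def by auto
  qed
  then show ?thesis
    using U by (auto simp: adj_def)
qed

lemma walk_copy_G:
  assumes "(x, x') \<in> adj G ^^ n" "h \<in> verts H"
  shows "((x, h), (x', h)) \<in> adj P ^^ n"
  using walk_map[of G "\<lambda>x. (x, h)" P, OF _ assms(1)] assms(2) by (auto simp: adj_product)

lemma walk_copy_H:
  assumes "(y, y') \<in> adj H ^^ n" "u \<in> U"
  shows "((u, y), (u, y')) \<in> adj P ^^ n"
  using walk_map[of H "Pair u" P, OF _ assms(1)] assms(2) by (auto simp: adj_product)

text \<open>The sum of the coordinate distances is a lower bound because every edge of the product changes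
  only one coordinate, along an edge of its factor.  It is attained by changing the \<open>H\<close>-coordinate
  in one go, at whichever end has its \<open>G\<close>-coordinate in \<open>U\<close>; if both ends lie in the same copy of
  \<open>G\<close>, it need not change at all.\<close>

lemma gdist_product:
  assumes "x \<in> verts G" "x' \<in> verts G" "y \<in> verts H" "y' \<in> verts H"
    and "x \<in> U \<or> x' \<in> U \<or> y = y'"
  shows "gdist P (x, y) (x', y') = gdist G x x' + gdist H y y'"
proof -
  let ?m = "gdist G x x'" and ?n = "gdist H y y'"
  have wG: "(x, x') \<in> adj G ^^ ?m" and wH: "(y, y') \<in> adj H ^^ ?n"
    using connected_walk_gdist[OF G assms(1,2)] connected_walk_gdist[OF H assms(3,4)] .
  have walk: "((x, y), (x', y')) \<in> adj P ^^ (?m + ?n)"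
    using assms(5)
  proof (elim disjE)
    assume "x \<in> U"
    then have "((x, y), (x', y')) \<in> adj P ^^ ?n O adj P ^^ ?m"
      using walk_copy_H[OF wH] walk_copy_G[OF wG assms(4)] by blast
    then show ?thesis by (simp add: add.commute flip: relpow_add)
  next
    assume "x' \<in> U"
    then have "((x, y), (x', y')) \<in> adj P ^^ ?m O adj P ^^ ?n"
      using walk_copy_H[OF wH] walk_copy_G[OF wG assms(3)] by blast
    then show ?thesis by (simp flip: relpow_add)
  next
    assume "y = y'"
    then show ?thesis using walk_copy_G[OF wG assms(3)] assms(3) by simp
  qed
  have start: "(x, y) \<in> verts P" using assms by simp
  have upper: "gdist P (x, y) (x', y') \<le> ?m + ?n"
    using gdist_le_walk[OF walk start] .
  let ?\<phi> = "\<lambda>(a, b). gdist G x a + gdist H y b"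
  have "?\<phi> q \<le> Suc (?\<phi> p)" if "p \<in> verts P" "(p, q) \<in> adj P" for p q
    using that gdist_adj_le[OF G assms(1)] gdist_adj_le[OF H assms(3)]
    by (cases p; cases q) (auto simp: adj_product)
  moreover have "((x, y), (x', y')) \<in> adj P ^^ gdist P (x, y) (x', y')"
    using path_of_walk[OF walk start] walk_gdist by metis
  ultimately have "?\<phi> (x', y') \<le> ?\<phi> (x, y) + gdist P (x, y) (x', y')"
    using walk_potential_le[of P ?\<phi>] start by blast
  then show ?thesis using upper assms by simp
qed

lemma edge_dist_copy_G:
  assumes "e \<in> edges G" "s \<in> verts G" "h \<in> verts H" "h' \<in> verts H" "s \<in> U \<or> h' = h"
  shows "edge_dist P (s, h') ((\<lambda>x. (x, h)) ` e) = edge_dist G s e + gdist H h' h"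
proof -
  note e = connected_graph_edge[OF G assms(1)]
  have "gdist P (s, h') ` (\<lambda>x. (x, h)) ` e = (\<lambda>x. gdist G s x + gdist H h' h) ` e"
    unfolding image_image
    using e(1) assms by (intro image_cong refl gdist_product) auto
  then show ?thesis
    unfolding edge_dist_def using e by (simp add: Min_add_commute)
qed

lemma edge_dist_copy_H:
  assumes "f \<in> edges H" "u \<in> U" "s \<in> verts G" "h \<in> verts H"
  shows "edge_dist P (s, h) (Pair u ` f) = gdist G s u + edge_dist H h f"
proof -
  note f = connected_graph_edge[OF H assms(1)]
  have u: "u \<in> verts G" using assms(2) U by blast
  have "gdist P (s, h) ` Pair u ` f = (\<lambda>y. gdist H h y + gdist G s u) ` f"
    unfolding image_image
    using f(1) assms u by (intro image_cong refl) (auto simp: gdist_product)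
  then show ?thesis
    unfolding edge_dist_def using f by (simp add: Min_add_commute)
qed

section \<open>Separating the edges of the product\<close>

text \<open>Suppose that no vertex \<open>(w, k)\<close> separates two given edges of the product.  Taking \<open>k\<close> among
  the \<open>H\<close>-coordinates of one edge shows that its \<open>G\<close>-coordinates are at least as far from \<open>w\<close> as
  those of the other; by symmetry both are equally far, and then every \<open>k\<close> occurring as
  \<open>H\<close>-coordinate in one edge must occur in the other.  The next three lemmas use this: two copies of
  edges of \<open>G\<close> lie in the same layer, two copies of edges of \<open>H\<close> come from the same edge, and in the
  mixed case an edge of \<open>H\<close> would collapse to a vertex.\<close>

lemma copies_G_same_layer:
  assumes "w \<in> U" "e \<in> edges G" "f \<in> edges G" "h \<in> verts H" "h' \<in> verts H"
    and eq: "\<And>k. k \<in> verts H \<Longrightarrow>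
      edge_dist P (w, k) ((\<lambda>x. (x, h)) ` e) = edge_dist P (w, k) ((\<lambda>x. (x, h')) ` f)"
  shows "h = h'"
proof -
  have w: "w \<in> verts G" using assms(1) U by blast
  have "edge_dist G w e + gdist H k h = edge_dist G w f + gdist H k h'" if "k \<in> verts H" for k
    using eq[OF that] assms that w by (simp add: edge_dist_copy_G)
  from this[of h] this[of h'] have "gdist H h h' = 0"
    using assms by simp
  then show ?thesis using gdist_eq_0[OF H] assms by simp
qed

lemma copy_G_copy_H_separated:
  assumes "w \<in> U" "e \<in> edges G" "h \<in> verts H" "u \<in> U" "f \<in> edges H"
  shows "\<exists>k\<in>verts H. edge_dist P (w, k) ((\<lambda>x. (x, h)) ` e) \<noteq> edge_dist P (w, k) (Pair u ` f)"
proof (rule ccontr)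
  assume neg: "\<not> ?thesis"
  have w: "w \<in> verts G" using assms(1) U by blast
  have eq: "edge_dist G w e + gdist H k h = gdist G w u + edge_dist H k f"
    if "k \<in> verts H" for k
    using neg assms that w by (metis edge_dist_copy_G edge_dist_copy_H)
  have "k = h" if "k \<in> f" for k
  proof -
    have k: "k \<in> verts H" using that connected_graph_edge(1)[OF H assms(5)] by blast
    then have "edge_dist H k f = 0"
      using edge_dist_eq_0[OF H assms(5)] that by simp
    then have "gdist H k h = 0"
      using eq[OF k] eq[OF assms(3)] assms(3) by simp
    then show ?thesis using gdist_eq_0[OF H k assms(3)] by simp
  qed
  then have "f \<subseteq> {h}" by blast
  then have "card f \<le> card {h}" by (rule card_mono[rotated]) simp
  then show False using connected_graph_edge(4)[OF H assms(5)] by simp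
qed

lemma copies_H_same_edge:
  assumes "w \<in> U" "u \<in> U" "u' \<in> U" "f \<in> edges H" "f' \<in> edges H"
    and eq: "\<And>k. k \<in> verts H \<Longrightarrow>
      edge_dist P (w, k) (Pair u ` f) = edge_dist P (w, k) (Pair u' ` f')"
  shows "f = f'"
proof (rule edge_subset_eq[OF H assms(4,5)], rule subsetI)
  fix k assume k: "k \<in> f"
  obtain k' where k': "k' \<in> f'"
    using connected_graph_edge(3)[OF H assms(5)] by blast
  have kv: "k \<in> verts H" "k' \<in> verts H"
    using k k' connected_graph_edge(1)[OF H] assms by blast+
  have w: "w \<in> verts G" using assms(1) U by blast
  have sum: "gdist G w u + edge_dist H i f = gdist G w u' + edge_dist H i f'" if "i \<in> verts H" for i
    using eq[OF that] assms that w by (simp add: edge_dist_copy_H)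
  have "edge_dist H k f = 0" "edge_dist H k' f' = 0"
    using edge_dist_eq_0[OF H] assms k k' kv by simp_all
  then have "edge_dist H k f' = 0"
    using sum[OF kv(1)] sum[OF kv(2)] by simp
  then show "k \<in> f'"
    using edge_dist_eq_0[OF H assms(5) kv(1)] by simp
qed

lemma product_edge_metric_generator:
  assumes SE: "\<And>u k. u \<in> U \<Longrightarrow> edge_discriminator G (edges_at_dist G u k) (SE u k)"
    and SU: "vertex_discriminator G U SU"
    and U2: "card U > 1" and w: "w \<in> U"
    and D: "D = insert w ((\<Union>u\<in>U. \<Union>k. SE u k) \<union> SU)" and DG: "D \<subseteq> verts G"
  shows "edge_metric_generator P (edges P) (D \<times> verts H)"
  unfolding edge_metric_generator_def
proof (intro conjI ballI impI)
  show "D \<times> verts H \<subseteq> verts P" using DG by auto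
next
  fix E F assume EF: "E \<in> edges P" "F \<in> edges P" "E \<noteq> F"
  show "\<exists>s\<in>D \<times> verts H. edge_dist P s E \<noteq> edge_dist P s F"
  proof (rule ccontr)
    assume "\<not> ?thesis"
    then have eq: "edge_dist P (s, k) E = edge_dist P (s, k) F" if "s \<in> D" "k \<in> verts H" for s k
      using that by blast
    have wD: "w \<in> D" using D by simp
    note weq = eq[OF wD]
    from EF(1) show False
    proof (cases rule: product_edge_cases)
      case E: (copy_G e h)
      from EF(2) show False
      proof (cases rule: product_edge_cases)
        case F: (copy_G f h')
        have "h = h'"
          using copies_G_same_layer[OF w E(1) F(1) E(2) F(2)] weq E(3) F(3) by blast
        then have ef: "e \<noteq> f" using EF(3) E(3) F(3) by blast
        have same: "edge_dist G s e = edge_dist G s f" if "s \<in> D" for s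
          using eq[OF that E(2)] E F \<open>h = h'\<close> that DG by (auto simp: edge_dist_copy_G)
        \<comment> \<open>As \<open>w\<close> itself is in \<open>D\<close>, the two edges are equally far from \<open>w\<close>, so a discriminator
          is responsible for them.\<close>
        define B where "B = edges_at_dist G w (edge_dist G w e)"
        have ef_in: "e \<in> B" "f \<in> B"
          using same[OF wD] E(1) F(1) by (auto simp: B_def edges_at_dist_def)
        have "finite B"
          using finite_edges[OF G] by (simp add: B_def edges_at_dist_def)
        then have "card {e, f} \<le> card B"
          using ef_in by (intro card_mono) auto
        then have "edge_metric_generator G B (SE w (edge_dist G w e))"
          using SE[OF w, of "edge_dist G w e"] ef by (simp add: edge_discriminator_def B_def)
        then obtain s where "s \<in> SE w (edge_dist G w e)" "edge_dist G s e \<noteq> edge_dist G s f"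
          using ef ef_in unfolding edge_metric_generator_def by blast
        moreover from this have "s \<in> D" using D w by blast
        ultimately show False using same by blast
      next
        case F: (copy_H u f)
        show False
          using copy_G_copy_H_separated[OF w E(1,2) F(1,2)] weq E(3) F(3) by blast
      qed
    next
      case E: (copy_H u f)
      from EF(2) show False
      proof (cases rule: product_edge_cases)
        case F: (copy_G e h)
        show False
          using copy_G_copy_H_separated[OF w F(1,2) E(1,2)] weq E(3) F(3) by metis
      next
        case F: (copy_H u' f')
        have "f = f'"
          using copies_H_same_edge[OF w E(1) F(1) E(2) F(2)] weq E(3) F(3) by blast
        then have "u \<noteq> u'" using EF(3) E(3) F(3) by blast
        then obtain s where s: "s \<in> SU" "gdist G s u \<noteq> gdist G s u'"
          using SU U2 E(1) F(1) unfolding vertex_discriminator_def metric_generator_def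
          by (auto split: if_splits) blast
        then have sD: "s \<in> D" "s \<in> verts G" using D DG by auto
        obtain k where "k \<in> f" "k \<in> verts H"
          using connected_graph_edge(1,3)[OF H E(2)] by blast
        then have "gdist G s u = gdist G s u'"
          using eq[OF sD(1)] E F sD(2) \<open>f = f'\<close> by (simp add: edge_dist_copy_H)
        then show False using s(2) by blast
      qed
    qed
  qed
qed

end

theorem theorem2p2:
  fixes G :: "'a graph" and H :: "'b graph" and U :: "'a set"
  assumes "connected_graph G"
    and "connected_graph H"
    and "U \<subseteq> verts G"
    and "card U > 1"
  shows "edim (hierarchical_product G U H) \<le> card (verts H) * (edim_plus G U + 1)"
proof -
  interpret hierarchical G H U using assms by unfold_locales
  obtain SE SU where
    SE: "\<And>u k. u \<in> U \<Longrightarrow> edge_discriminator G (edges_at_dist G u k) (SE u k)" and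
    SU: "vertex_discriminator G U SU" and
    card_D: "card ((\<Union>u\<in>U. \<Union>k. SE u k) \<union> SU) = edim_plus G U"
    using edim_plus_attained[OF assms(1,3)] by blast
  let ?D = "(\<Union>u\<in>U. \<Union>k. SE u k) \<union> SU"
  obtain w where w: "w \<in> U" using assms(4) by fastforce
  have "SE u k \<subseteq> verts G" if "u \<in> U" for u k
    using SE[OF that, of k]
    by (auto simp: edge_discriminator_def edge_metric_generator_def split: if_splits)
  moreover have "SU \<subseteq> verts G"
    using SU assms(4) by (auto simp: vertex_discriminator_def metric_generator_def)
  ultimately have DG: "insert w ?D \<subseteq> verts G" using w assms(3) by blast
  have "edge_metric_generator P (edges P) (insert w ?D \<times> verts H)"
    by (rule product_edge_metric_generator[OF SE SU assms(4) w refl DG])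
  then have "edim P \<le> card (insert w ?D \<times> verts H)"
    unfolding edim_def by (intro Least_le) blast
  also have "\<dots> = card (verts H) * card (insert w ?D)"
    by (simp add: card_cartesian_product)
  also have "\<dots> \<le> card (verts H) * (edim_plus G U + 1)"
  proof (intro mult_le_mono2)
    have "finite ?D"
      using DG assms(1) finite_subset by (auto simp: connected_graph_def simple_graph_def)
    then show "card (insert w ?D) \<le> edim_plus G U + 1"
      using card_D by (simp add: card_insert_if)
  qed
  finally show ?thesis .
qed

end
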